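(* If a VERS is expanding, then its history graph is (Gromov) hyperbolic.
   Context: Graphs have vertex set, edge set and maps $\iota,\tau$ (initial/terminal vertex); loops and parallel edges allowed; paths, geodesics and graph distance ignore orientation (distance $\infty$ across components). Let $\Sigma$ be a finite directed graph, $s\in V(\Sigma)$. The language $\mathcal L$ is the set of finite directed paths in $\Sigma$ from $s$, written as words $x_n\cdots x_1$ over $E(\Sigma)$ ($\iota(x_1)=s$, $\tau(x_i)=\iota(x_{i+1})$), including the empty word $\varepsilon$; the type of a word is the terminal vertex of its path ($s$ for $\varepsilon$). For a color set $C$ and $\kappa\colon C\to V(\Sigma)^2$, a graph with $C$-colored edges and $V(\Sigma)$-typed vertices is $\kappa$-compatible if every edge $e$ of color $c$ has $\mathrm{type}(\iota(e))=\kappa(c)_1$ and $\mathrm{type}(\tau(e))=\kappa(c)_2$. A VERS consists of $(\Sigma,s)$, a finite color set $C$, $\kappa$, for each $c\in C$ a $\kappa$-compatible $C$-colored graph $R_c$ with vertex set $\{x\mathrm i:\iota(x)=\kappa(c)_1\}\cup\{y\mathrm t:\iota(y)=\kappa(c)_2\}$ ($x,y\in E(\Sigma)$; $x\mathrm i,x\mathrm t$ of type $\tau(x)$), and a $\kappa$-compatible graph $\Gamma_0$: the vertex $\varepsilon$ with a bouquet of $C$-colored loops. The expansion of a $\kappa$-compatible graph $\Gamma$ has vertices $xu$ ($u\in V(\Gamma)$, $x\in E(\Sigma)$, $\iota(x)=\mathrm{type}(u)$; type $\tau(x)$) and, for each edge of $\Gamma$ from $u$ to $v$ of color $c$ and each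 edge of $R_c$ of color $c'$, a $c'$-colored edge obtained by replacing $\mathrm i$ by $u$ and $\mathrm t$ by $v$ in its endpoints. $\Gamma_{n+1}$ is the expansion of $\Gamma_n$. The $k$-th expansion is obtained by expanding $k$ times; its vertices are the words $wu$ with $u$ a vertex of the original graph and $|w|=k$ (the successors of $u$). The history graph has vertex set $\mathcal L$, vertical edges $v\to xv$ (for $v,xv\in\mathcal L$, $x\in E(\Sigma)$) and horizontal edges all edges of all $\Gamma_n$. The VERS is $n$-expanding if for every $\kappa$-compatible graph $\Gamma$ that is a path of length $n$ (with arbitrary colors and edge orientations) with endpoints $a,b$, the $n$-th expansion of $\Gamma$ contains no geodesic of length $n$ joining a successor of $a$ to a successor of $b$. It is expanding if it is $n$-expanding for some $n\in\mathbb N$. *)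

theory Defs
  imports Complex_Main "HOL-Library.Extended_Nat" "Graph_Theory.Digraph" "Graph_Theory.Arc_Walk"
begin

section \<open>Unoriented paths, distance, geodesics, hyperbolicity\<close>

text \<open>A path is given by its list of arcs, each of which may be traversed in either direction.\<close>

fun uwalk :: "('a,'b) pre_digraph \<Rightarrow> 'a \<Rightarrow> 'b list \<Rightarrow> 'a \<Rightarrow> bool" where
  "uwalk G u [] v \<longleftrightarrow> u = v \<and> u \<in> verts G"
| "uwalk G u (e # p) v \<longleftrightarrow> e \<in> arcs G \<and>
     (tail G e = u \<and> uwalk G (head G e) p v \<or> head G e = u \<and> uwalk G (tail G e) p v)"

definition gdist :: "('a,'b) pre_digraph \<Rightarrow> 'a \<Rightarrow> 'a \<Rightarrow> enat" where
  "gdist G u v = (INF p \<in> {p. uwalk G u p v}. enat (length p))"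

definition geodesic :: "('a,'b) pre_digraph \<Rightarrow> 'a \<Rightarrow> 'b list \<Rightarrow> 'a \<Rightarrow> bool" where
  "geodesic G u p v \<longleftrightarrow> uwalk G u p v \<and> enat (length p) = gdist G u v"

definition gromov_product :: "('a \<Rightarrow> 'a \<Rightarrow> real) \<Rightarrow> 'a \<Rightarrow> 'a \<Rightarrow> 'a \<Rightarrow> real" where
  "gromov_product d b x y = (d b x + d b y - d x y) / 2"

definition gromov_hyperbolic :: "'a set \<Rightarrow> ('a \<Rightarrow> 'a \<Rightarrow> real) \<Rightarrow> bool" where
  "gromov_hyperbolic M d \<longleftrightarrow> (\<exists>\<delta>\<ge>0. \<forall>b\<in>M. \<forall>x\<in>M. \<forall>y\<in>M. \<forall>z\<in>M.
     gromov_product d b x z \<ge> min (gromov_product d b x y) (gromov_product d b y z) - \<delta>)"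

text \<open>
  A graph is hyperbolic if it is connected and its vertex set with the graph distance is a
  Gromov hyperbolic metric space.  The vertex set is \<open>1/2\<close>-dense in the geometric realization,
  so using the latter instead only affects the constant.
\<close>

definition hyperbolic_graph :: "('a,'b) pre_digraph \<Rightarrow> bool" where
  "hyperbolic_graph G \<longleftrightarrow>
     (\<forall>u\<in>verts G. \<forall>v\<in>verts G. gdist G u v \<noteq> \<infinity>) \<and>
     gromov_hyperbolic (verts G) (\<lambda>u v. real (the_enat (gdist G u v)))"

definition is_path_graph :: "('a,'b) pre_digraph \<Rightarrow> nat \<Rightarrow> 'a \<Rightarrow> 'a \<Rightarrow> bool" where
  "is_path_graph G n a b \<longleftrightarrow> (\<exists>p q.
     bij_betw p {0..n} (verts G) \<and> bij_betw q {0..<n} (arcs G) \<and> p 0 = a \<and> p n = b \<and>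
     (\<forall>i<n. {tail G (q i), head G (q i)} = {p i, p (Suc i)}))"

section \<open>Vertex-edge replacement systems\<close>

record ('a,'b,'c,'v) cgraph =
  under :: "('a,'b) pre_digraph"
  ecol :: "'b \<Rightarrow> 'c"
  vtyp :: "'a \<Rightarrow> 'v"

text \<open>\<open>I x\<close> and \<open>T x\<close> stand for the vertices \<open>x\<close>i and \<open>x\<close>t of the replacement graphs.\<close>

datatype 'e rvert = I 'e | T 'e

text \<open>
  \<open>Sig\<close> is the graph \<open>\<Sigma>\<close>, \<open>repl X c\<close> is \<open>R\<^sub>c\<close>, and \<open>init X\<close> is \<open>\<Gamma>\<^sub>0\<close>, whose only vertex,
  the empty word, is rendered as \<open>()\<close>.
\<close>

record ('v,'e,'c,'r,'l) vers =
  Sig :: "('v,'e) pre_digraph"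
  start :: 'v
  colors :: "'c set"
  kappa :: "'c \<Rightarrow> 'v \<times> 'v"
  repl :: "'c \<Rightarrow> ('e rvert, 'r, 'c, 'v) cgraph"
  init :: "(unit, 'l, 'c, 'v) cgraph"

definition compatible :: "('v,'e,'c,'r,'l) vers \<Rightarrow> ('a,'b,'c,'v) cgraph \<Rightarrow> bool" where
  "compatible X G \<longleftrightarrow> wf_digraph (under G) \<and>
     (\<forall>u\<in>verts (under G). vtyp G u \<in> verts (Sig X)) \<and>
     (\<forall>e\<in>arcs (under G). ecol G e \<in> colors X \<and>
        vtyp G (tail (under G) e) = fst (kappa X (ecol G e)) \<and>
        vtyp G (head (under G) e) = snd (kappa X (ecol G e)))"

definition is_vers :: "('v,'e,'c,'r,'l) vers \<Rightarrow> bool" where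
  "is_vers X \<longleftrightarrow>
     fin_digraph (Sig X) \<and> start X \<in> verts (Sig X) \<and>
     finite (colors X) \<and> (\<forall>c\<in>colors X. kappa X c \<in> verts (Sig X) \<times> verts (Sig X)) \<and>
     (\<forall>c\<in>colors X. compatible X (repl X c) \<and>
        verts (under (repl X c)) =
          {I x | x. x \<in> arcs (Sig X) \<and> tail (Sig X) x = fst (kappa X c)} \<union>
          {T y | y. y \<in> arcs (Sig X) \<and> tail (Sig X) y = snd (kappa X c)} \<and>
        (\<forall>x. I x \<in> verts (under (repl X c)) \<longrightarrow> vtyp (repl X c) (I x) = head (Sig X) x) \<and>
        (\<forall>x. T x \<in> verts (under (repl X c)) \<longrightarrow> vtyp (repl X c) (T x) = head (Sig X) x)) \<and>
     compatible X (init X) \<and> verts (under (init X)) = {()} \<and> vtyp (init X) () = start X"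

section \<open>Expansions\<close>

text \<open>
  To iterate expansions without changing types, a vertex \<open>w u\<close> of an iterated expansion of a graph
  is the pair \<open>(w, u)\<close> of a word and a vertex of the original graph.  Likewise, an arc is a pair
  \<open>([r\<^sub>k, \<dots>, r\<^sub>1], e)\<close>: the arc \<open>e\<close> of the original graph was replaced by the graph
  containing \<open>r\<^sub>1\<close>, the copy of \<open>r\<^sub>1\<close> by the graph containing \<open>r\<^sub>2\<close>, and so on.
\<close>

fun prepend :: "'x \<Rightarrow> 'x list \<times> 'a \<Rightarrow> 'x list \<times> 'a" where
  "prepend x (w, u) = (x # w, u)"

fun first :: "'x list \<times> 'a \<Rightarrow> 'x" where
  "first (w, u) = hd w"

fun parent :: "'x list \<times> 'a \<Rightarrow> 'x list \<times> 'a" where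
  "parent (w, u) = (tl w, u)"

fun replace_it :: "'e list \<times> 'a \<Rightarrow> 'e list \<times> 'a \<Rightarrow> 'e rvert \<Rightarrow> 'e list \<times> 'a" where
  "replace_it u v (I x) = prepend x u"
| "replace_it u v (T x) = prepend x v"

definition expand :: "('v,'e,'c,'r,'l) vers \<Rightarrow>
    ('e list \<times> 'a, 'r list \<times> 'b, 'c, 'v) cgraph \<Rightarrow> ('e list \<times> 'a, 'r list \<times> 'b, 'c, 'v) cgraph" where
  "expand X G =
     (let R = (\<lambda>e. repl X (ecol G (parent e)));
          sub = (\<lambda>e. replace_it (tail (under G) (parent e)) (head (under G) (parent e)))
      in \<lparr> under =
             \<lparr> verts = {prepend x u | x u. u \<in> verts (under G) \<and> x \<in> arcs (Sig X) \<and>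
                                          tail (Sig X) x = vtyp G u},
               arcs = {prepend r e | r e. e \<in> arcs (under G) \<and>
                                         r \<in> arcs (under (repl X (ecol G e)))},
               tail = (\<lambda>e. sub e (tail (under (R e)) (first e))),
               head = (\<lambda>e. sub e (head (under (R e)) (first e))) \<rparr>,
           ecol = (\<lambda>e. ecol (R e) (first e)),
           vtyp = (\<lambda>u. head (Sig X) (first u)) \<rparr>)"

definition zeroth_expansion ::
    "('a,'b,'c,'v) cgraph \<Rightarrow> ('e list \<times> 'a, 'r list \<times> 'b, 'c, 'v) cgraph" where
  "zeroth_expansion G =
     \<lparr> under = \<lparr> verts = {[]} \<times> verts (under G), arcs = {[]} \<times> arcs (under G),
                 tail = (\<lambda>(_, e). ([], tail (under G) e)),
                 head = (\<lambda>(_, e). ([], head (under G) e)) \<rparr>,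
       ecol = (\<lambda>(_, e). ecol G e),
       vtyp = (\<lambda>(_, u). vtyp G u) \<rparr>"

definition expansion :: "('v,'e,'c,'r,'l) vers \<Rightarrow> nat \<Rightarrow>
    ('a,'b,'c,'v) cgraph \<Rightarrow> ('e list \<times> 'a, 'r list \<times> 'b, 'c, 'v) cgraph" where
  "expansion X k G = (expand X ^^ k) (zeroth_expansion G)"

definition successors ::
    "('v,'e,'c,'r,'l) vers \<Rightarrow> nat \<Rightarrow> ('a,'b,'c,'v) cgraph \<Rightarrow> 'a \<Rightarrow> ('e list \<times> 'a) set" where
  "successors X k G u =
     {(w, u) | w. (w, u) \<in> verts (under (expansion X k G))}"

text \<open>Every finite graph is isomorphic to one whose vertices and arcs are natural numbers.\<close>

definition n_expanding :: "('v,'e,'c,'r,'l) vers \<Rightarrow> nat \<Rightarrow> bool" where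
  "n_expanding X n \<longleftrightarrow> (\<forall>(G :: (nat,nat,'c,'v) cgraph) a b.
     compatible X G \<and> is_path_graph (under G) n a b \<longrightarrow>
     \<not> (\<exists>u \<in> successors X n G a. \<exists>v \<in> successors X n G b. \<exists>p.
          geodesic (under (expansion X n G)) u p v \<and> length p = n))"

definition expanding :: "('v,'e,'c,'r,'l) vers \<Rightarrow> bool" where
  "expanding X \<longleftrightarrow> (\<exists>n. n_expanding X n)"

section \<open>The history graph\<close>

text \<open>\<open>Gam X n\<close> is \<open>\<Gamma>\<^sub>n\<close>; the word \<open>w\<close> appears in it as \<open>(w, ())\<close>.\<close>

definition Gam ::
    "('v,'e,'c,'r,'l) vers \<Rightarrow> nat \<Rightarrow> ('e list \<times> unit, 'r list \<times> 'l, 'c, 'v) cgraph" where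
  "Gam X n = expansion X n (init X)"

text \<open>The word \<open>x\<^sub>n \<dots> x\<^sub>1\<close> is the list \<open>[x\<^sub>n, \<dots>, x\<^sub>1]\<close>, which traverses the path backwards.\<close>

definition lang :: "('v,'e,'c,'r,'l) vers \<Rightarrow> 'e list set" where
  "lang X = {w. \<exists>v. pre_digraph.awalk (Sig X) (start X) (rev w) v}"

datatype ('e,'r,'l) hedge = Vertical 'e "'e list" | Horizontal nat "'r list \<times> 'l"

definition history_graph ::
    "('v,'e,'c,'r,'l) vers \<Rightarrow> ('e list, ('e,'r,'l) hedge) pre_digraph" where
  "history_graph X =
     \<lparr> verts = lang X,
       arcs = {Vertical x v | x v. x \<in> arcs (Sig X) \<and> v \<in> lang X \<and> x # v \<in> lang X} \<union>
              {Horizontal n e | n e. e \<in> arcs (under (Gam X n))},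
       tail = (\<lambda>h. case h of Vertical x v \<Rightarrow> v
                           | Horizontal n e \<Rightarrow> fst (tail (under (Gam X n)) e)),
       head = (\<lambda>h. case h of Vertical x v \<Rightarrow> x # v
                           | Horizontal n e \<Rightarrow> fst (head (under (Gam X n)) e)) \<rparr>"

end

theory Submission
  imports Defs
begin

text \<open>
  Passing to parents does not increase the distances in the graphs \<open>\<Gamma>\<^sub>m\<close>. If the system is
  \<open>n\<close>-expanding, then walks of length \<open>n\<close> even get shorter \<open>n\<close> levels up, so that in a long
  horizontal walk each chunk of length \<open>n\<close> loses an edge. Hence, up to an additive constant, the
  Gromov product of two words based at the empty word is the last level on which their ancestors
  are at horizontal distance at most \<open>2 n\<^sup>2\<close>. The ultrametric inequality up to a constant
  follows: if the ancestors of \<open>x\<close>, \<open>y\<close> and those of \<open>y\<close>, \<open>z\<close> are that close on some level,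
  then those of \<open>x\<close>, \<open>z\<close> are that close a bounded number of levels further up.
\<close>

section \<open>Unoriented walks\<close>

lemma (in wf_digraph) uwalk_start_in_verts: "uwalk G u p v \<Longrightarrow> u \<in> verts G"
  by (cases p) auto

lemma uwalk_end_in_verts: "uwalk G u p v \<Longrightarrow> v \<in> verts G"
  by (induction p arbitrary: u) auto

lemma uwalk_append: "uwalk G u p v \<Longrightarrow> uwalk G v q w \<Longrightarrow> uwalk G u (p @ q) w"
  by (induction p arbitrary: u) auto

lemma (in wf_digraph) uwalk_splitE:
  assumes "uwalk G u (p @ q) w"
  obtains v where "uwalk G u p v" and "uwalk G v q w"
  using assms
proof (induction p arbitrary: u thesis)
  case Nil
  then show ?case using uwalk_start_in_verts by auto
next
  case (Cons e p)
  then show ?case by auto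
qed

lemma (in wf_digraph) uwalk_rev: "uwalk G u p v \<Longrightarrow> uwalk G v (rev p) u"
proof (induction p arbitrary: u)
  case (Cons e p)
  then obtain u' where "uwalk G u' p v" and "uwalk G u' [e] u" by auto
  then show ?case using Cons.IH uwalk_append[of G v "rev p" u' "[e]" u] by auto
qed auto

lemma uwalk_map:
  assumes "uwalk G u p v"
    and "\<And>w. w \<in> verts G \<Longrightarrow> f w \<in> verts H"
    and "\<And>e. e \<in> arcs G \<Longrightarrow> g e \<in> arcs H \<and> tail H (g e) = f (tail G e) \<and> head H (g e) = f (head G e)"
  shows "uwalk H (f u) (map g p) (f v)"
  using assms(1) by (induction p arbitrary: u) (use assms in auto)

text \<open>Numbering the vertices of a walk makes it possible to compare two of them and to cut the
  walk between them, which the recursion on arc lists hides.\<close>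

lemma uwalk_seqE:
  assumes "uwalk G u p v"
  obtains f where "f 0 = u" and "f (length p) = v"
    and "\<And>i. i < length p \<Longrightarrow> p ! i \<in> arcs G \<and>
      (tail G (p ! i) = f i \<and> head G (p ! i) = f (Suc i) \<or>
       tail G (p ! i) = f (Suc i) \<and> head G (p ! i) = f i)"
proof -
  have "\<exists>f. f 0 = u \<and> f (length p) = v \<and> (\<forall>i < length p. p ! i \<in> arcs G \<and>
      (tail G (p ! i) = f i \<and> head G (p ! i) = f (Suc i) \<or>
       tail G (p ! i) = f (Suc i) \<and> head G (p ! i) = f i))"
    using assms
  proof (induction p arbitrary: u)
    case Nil
    then show ?case by auto
  next
    case (Cons e p)
    then obtain u' where u': "uwalk G u' p v" and e: "e \<in> arcs G"
      "tail G e = u \<and> head G e = u' \<or> tail G e = u' \<and> head G e = u" by auto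
    from Cons.IH[OF u'] obtain f where f: "f 0 = u'" "f (length p) = v"
      "\<forall>i < length p. p ! i \<in> arcs G \<and>
      (tail G (p ! i) = f i \<and> head G (p ! i) = f (Suc i) \<or>
       tail G (p ! i) = f (Suc i) \<and> head G (p ! i) = f i)" by auto
    have "\<forall>i < length (e # p). (e # p) ! i \<in> arcs G \<and>
      (tail G ((e # p) ! i) = case_nat u f i \<and> head G ((e # p) ! i) = case_nat u f (Suc i) \<or>
       tail G ((e # p) ! i) = case_nat u f (Suc i) \<and> head G ((e # p) ! i) = case_nat u f i)"
    proof (intro allI impI)
      fix i assume "i < length (e # p)"
      then show "(e # p) ! i \<in> arcs G \<and>
      (tail G ((e # p) ! i) = case_nat u f i \<and> head G ((e # p) ! i) = case_nat u f (Suc i) \<or>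
       tail G ((e # p) ! i) = case_nat u f (Suc i) \<and> head G ((e # p) ! i) = case_nat u f i)"
        using e f by (cases i) auto
    qed
    then show ?case using f(2) by (intro exI[of _ "case_nat u f"]) auto
  qed
  then show thesis using that by blast
qed

text \<open>The converse passage, for any segment of an indexed walk. Only the last vertex must be
  assumed to lie in \<open>G\<close>, because \<open>uwalk\<close> tests vertices only at the end of
  its recursion.\<close>

lemma uwalk_of_seq:
  assumes "f j \<in> verts G" and "i \<le> j"
    and "\<And>k. i \<le> k \<Longrightarrow> k < j \<Longrightarrow> g k \<in> arcs G \<and>
      (tail G (g k) = f k \<and> head G (g k) = f (Suc k) \<or>
       tail G (g k) = f (Suc k) \<and> head G (g k) = f k)"
  shows "uwalk G (f i) (map g [i..<j]) (f j)"
  using assms(2,3)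
proof (induction i rule: inc_induct)
  case base
  then show ?case using assms(1) by simp
next
  case (step i)
  have "[i..<j] = i # [Suc i..<j]" using step.hyps by (simp add: upt_conv_Cons)
  moreover have "uwalk G (f (Suc i)) (map g [Suc i..<j]) (f j)" using step by simp
  ultimately show ?case using step.prems[of i] step.hyps by auto
qed

section \<open>Distances and shortest walks\<close>

lemma gdist_le: "uwalk G u p v \<Longrightarrow> gdist G u v \<le> enat (length p)"
  unfolding gdist_def by (auto intro: INF_lower)

lemma gdist_attained:
  assumes "uwalk G u p v"
  obtains q where "uwalk G u q v" and "gdist G u v = enat (length q)"
proof -
  let ?A = "(\<lambda>p. enat (length p)) ` {p. uwalk G u p v}"
  have "Inf ?A \<in> ?A" using assms by (intro wellorder_InfI[of "enat (length p)"]) auto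
  then show thesis using that unfolding gdist_def by auto
qed

lemma geodesicI:
  assumes "uwalk G u p v" and "\<And>q. uwalk G u q v \<Longrightarrow> length p \<le> length q"
  shows "geodesic G u p v"
  using assms gdist_attained[OF assms(1)] gdist_le[OF assms(1)]
  unfolding geodesic_def by (metis antisym enat_ord_simps(1))

lemma (in wf_digraph) gdist_sym: "gdist G u v = gdist G v u"
proof -
  have "gdist G v u \<le> gdist G u v" for u v
    unfolding gdist_def[of G u v]
  proof (rule INF_greatest)
    fix p assume "p \<in> {p. uwalk G u p v}"
    then have "uwalk G v (rev p) u" by (simp add: uwalk_rev)
    then have "gdist G v u \<le> enat (length (rev p))" by (rule gdist_le)
    then show "gdist G v u \<le> enat (length p)" by simp
  qed
  then show ?thesis by (simp add: antisym)
qed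

section \<open>Change of base point\<close>

text \<open>Rewritten with the products \<open>g\<close> based at \<open>r\<close>, the inequality
  at any base \<open>b\<close> becomes a condition on the sums of \<open>g\<close> over the three
  ways to pair off \<open>b\<close>, \<open>x\<close>, \<open>y\<close>, \<open>z\<close>. Two uses
  of the inequality at \<open>r\<close> cost \<open>2 * \<delta>\<close>.\<close>

lemma gromov_hyperbolic_if_one_base:
  assumes "\<delta> \<ge> 0" and "r \<in> M"
    and sym: "\<And>x y. x \<in> M \<Longrightarrow> y \<in> M \<Longrightarrow> d x y = d y x"
    and base: "\<And>x y z. x \<in> M \<Longrightarrow> y \<in> M \<Longrightarrow> z \<in> M \<Longrightarrow>
      gromov_product d r x z \<ge> min (gromov_product d r x y) (gromov_product d r y z) - \<delta>"
  shows "gromov_hyperbolic M d"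
  unfolding gromov_hyperbolic_def
proof (intro exI[of _ "2 * \<delta>"] conjI ballI)
  fix b x y z assume M: "b \<in> M" "x \<in> M" "y \<in> M" "z \<in> M"
  define g where "g = gromov_product d r"
  have g_sym: "g u v = g v u" if "u \<in> M" "v \<in> M" for u v
    using sym that unfolding g_def gromov_product_def by simp
  have d: "d u v = d r u + d r v - 2 * g u v" for u v
    unfolding g_def gromov_product_def by (simp add: field_simps)
  have g: "g u w \<ge> g u v - \<delta> \<or> g u w \<ge> g v w - \<delta>" if "u \<in> M" "v \<in> M" "w \<in> M" for u v w
    using base[OF that] unfolding g_def by linarith
  \<comment> \<open>Pick the largest of the four products on the right. The two triangles through it
    bound \<open>g x z\<close> and \<open>g b y\<close> from below by the products of the pairing to
    which it does not belong, each up to \<delta>.\<close>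
  have "g x z + g b y \<ge> g x y + g b z - 2 * \<delta> \<or> g x z + g b y \<ge> g y z + g b x - 2 * \<delta>"
    using g[of x y z] g[of x b z] g[of b x y] g[of b z y] g[of y x z] M \<open>\<delta> \<ge> 0\<close>
      g_sym[of z b] g_sym[of y x] g_sym[of z y] g_sym[of x b]
    by (smt (verit))
  moreover have "gromov_product d b u v = d r b - g b u - g b v + g u v" for u v
    unfolding gromov_product_def d[of b] d[of u v] by (simp add: field_simps)
  ultimately show "gromov_product d b x z \<ge>
      min (gromov_product d b x y) (gromov_product d b y z) - 2 * \<delta>"
    by (smt (verit))
qed (use \<open>\<delta> \<ge> 0\<close> in simp)

section \<open>Expansions\<close>

lemma parent_prepend [simp]: "parent (prepend x u) = u"
  by (cases u) simp

lemma first_prepend [simp]: "first (prepend x u) = x"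
  by (cases u) simp

lemma prepend_eq_iff [simp]: "prepend x u = prepend y v \<longleftrightarrow> x = y \<and> u = v"
  by (cases u; cases v) auto

lemma fst_prepend [simp]: "fst (prepend x u) = x # fst u"
  by (cases u) simp

lemma snd_prepend [simp]: "snd (prepend x u) = snd u"
  by (cases u) simp

lemma verts_expand: "verts (under (expand X G)) =
    {prepend x u | x u. u \<in> verts (under G) \<and> x \<in> arcs (Sig X) \<and> tail (Sig X) x = vtyp G u}"
  by (simp add: expand_def Let_def)

lemma arcs_expand: "arcs (under (expand X G)) =
    {prepend r e | r e. e \<in> arcs (under G) \<and> r \<in> arcs (under (repl X (ecol G e)))}"
  by (simp add: expand_def Let_def)

lemma prepend_in_verts_expand_iff: "prepend x u \<in> verts (under (expand X G)) \<longleftrightarrow>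
    u \<in> verts (under G) \<and> x \<in> arcs (Sig X) \<and> tail (Sig X) x = vtyp G u"
  by (simp add: verts_expand del: split_paired_Ex)

lemma prepend_in_arcs_expand_iff: "prepend r e \<in> arcs (under (expand X G)) \<longleftrightarrow>
    e \<in> arcs (under G) \<and> r \<in> arcs (under (repl X (ecol G e)))"
  by (simp add: arcs_expand del: split_paired_Ex)

lemma in_verts_expandE:
  assumes "w \<in> verts (under (expand X G))"
  obtains x u where "w = prepend x u" and "u \<in> verts (under G)"
    and "x \<in> arcs (Sig X)" and "tail (Sig X) x = vtyp G u"
  using assms unfolding verts_expand by blast

lemma in_arcs_expandE:
  assumes "a \<in> arcs (under (expand X G))"
  obtains r e where "a = prepend r e" and "e \<in> arcs (under G)"
    and "r \<in> arcs (under (repl X (ecol G e)))"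
  using assms unfolding arcs_expand by blast

lemma tail_expand: "tail (under (expand X G)) (prepend r e) =
    replace_it (tail (under G) e) (head (under G) e) (tail (under (repl X (ecol G e))) r)"
  by (simp add: expand_def Let_def)

lemma head_expand: "head (under (expand X G)) (prepend r e) =
    replace_it (tail (under G) e) (head (under G) e) (head (under (repl X (ecol G e))) r)"
  by (simp add: expand_def Let_def)

lemma ecol_expand: "ecol (expand X G) (prepend r e) = ecol (repl X (ecol G e)) r"
  by (simp add: expand_def Let_def)

lemma vtyp_expand: "vtyp (expand X G) (prepend x u) = head (Sig X) x"
  by (simp add: expand_def Let_def)

lemmas expand_simps = tail_expand head_expand ecol_expand vtyp_expand

lemma parent_replace_it: "parent (replace_it u v y) \<in> {u, v}"
  by (cases y) auto

lemma compatible_expand: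
  assumes X: "is_vers X" and G: "compatible X G"
  shows "compatible X (expand X G)"
proof -
  interpret Sig: fin_digraph "Sig X" using X by (simp add: is_vers_def)
  interpret G: wf_digraph "under G" using G by (simp add: compatible_def)
  \<comment> \<open>The color of \<open>e\<close> fixes the types of its ends through
    \<open>kappa\<close>, and the vertices \<open>I x\<close> and \<open>T x\<close> of its
    replacement graph are precisely the letters that may precede ends of these types.\<close>
  have end_ok: "replace_it (tail (under G) e) (head (under G) e) y \<in> verts (under (expand X G)) \<and>
      vtyp (expand X G) (replace_it (tail (under G) e) (head (under G) e) y) =
      vtyp (repl X (ecol G e)) y"
    if e: "e \<in> arcs (under G)" and y: "y \<in> verts (under (repl X (ecol G e)))" for e y
  proof -
    have c: "ecol G e \<in> colors X"
      "vtyp G (tail (under G) e) = fst (kappa X (ecol G e))"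
      "vtyp G (head (under G) e) = snd (kappa X (ecol G e))"
      using G e by (auto simp: compatible_def)
    have R: "verts (under (repl X (ecol G e))) =
          {I x | x. x \<in> arcs (Sig X) \<and> tail (Sig X) x = fst (kappa X (ecol G e))} \<union>
          {T y | y. y \<in> arcs (Sig X) \<and> tail (Sig X) y = snd (kappa X (ecol G e))}"
      "\<And>x. I x \<in> verts (under (repl X (ecol G e))) \<Longrightarrow>
        vtyp (repl X (ecol G e)) (I x) = head (Sig X) x"
      "\<And>x. T x \<in> verts (under (repl X (ecol G e))) \<Longrightarrow>
        vtyp (repl X (ecol G e)) (T x) = head (Sig X) x"
      using X c(1) by (auto simp: is_vers_def)
    show ?thesis
      using y R c e by (cases y) (auto simp: prepend_in_verts_expand_iff vtyp_expand)
  qed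
  have arc_ok: "tail (under (expand X G)) e \<in> verts (under (expand X G)) \<and>
      head (under (expand X G)) e \<in> verts (under (expand X G)) \<and>
      ecol (expand X G) e \<in> colors X \<and>
      vtyp (expand X G) (tail (under (expand X G)) e) = fst (kappa X (ecol (expand X G) e)) \<and>
      vtyp (expand X G) (head (under (expand X G)) e) = snd (kappa X (ecol (expand X G) e))"
    if a: "e \<in> arcs (under (expand X G))" for e
  proof -
    obtain r e' where e: "e = prepend r e'" and e': "e' \<in> arcs (under G)"
      and r: "r \<in> arcs (under (repl X (ecol G e')))"
      using a by (rule in_arcs_expandE)
    have "ecol G e' \<in> colors X" using G e' by (auto simp: compatible_def)
    then have R: "compatible X (repl X (ecol G e'))" using X by (simp add: is_vers_def)
    then interpret R: wf_digraph "under (repl X (ecol G e'))" by (simp add: compatible_def)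
    show ?thesis
      using R r end_ok[OF e' R.tail_in_verts[OF r]] end_ok[OF e' R.head_in_verts[OF r]]
      by (auto simp: e expand_simps compatible_def)
  qed
  show ?thesis
    unfolding compatible_def
  proof (intro conjI ballI)
    show "wf_digraph (under (expand X G))" using arc_ok by unfold_locales auto
    show "vtyp (expand X G) u \<in> verts (Sig X)" if "u \<in> verts (under (expand X G))" for u
      using that by (elim in_verts_expandE) (simp add: vtyp_expand)
  qed (use arc_ok in auto)
qed

lemma compatible_expand_funpow:
  "is_vers X \<Longrightarrow> compatible X G \<Longrightarrow> compatible X ((expand X ^^ k) G)"
  by (induction k) (auto intro: compatible_expand)

lemma compatible_zeroth_expansion: "compatible X G \<Longrightarrow> compatible X (zeroth_expansion G)"
  by (auto simp: compatible_def zeroth_expansion_def wf_digraph_def)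

text \<open>Words grow at the front, so the first \<open>k\<close> letters are the latest ones. The
  polymorphic form serves vertices and arcs alike.\<close>

definition ancestor :: "nat \<Rightarrow> 'x list \<times> 'a \<Rightarrow> 'x list \<times> 'a" where
  "ancestor k u = (drop k (fst u), snd u)"

lemma ancestor_0 [simp]: "ancestor 0 u = u"
  by (simp add: ancestor_def)

lemma ancestor_prepend [simp]: "ancestor (Suc k) (prepend x u) = ancestor k u"
  by (simp add: ancestor_def)

lemma ancestor_Suc: "ancestor (Suc k) u = ancestor k (parent u)"
  by (cases u) (simp add: ancestor_def drop_Suc)

lemma ancestor_vert:
  "u \<in> verts (under ((expand X ^^ k) G)) \<Longrightarrow> ancestor k u \<in> verts (under G)"
proof (induction k arbitrary: u)
  case (Suc k)
  then obtain x u' where "u = prepend x u'" and "u' \<in> verts (under ((expand X ^^ k) G))"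
    by (auto elim: in_verts_expandE)
  then show ?case using Suc.IH by simp
qed simp

text \<open>By \<open>parent_replace_it\<close>, one expansion sends both ends of a new arc to ends
  of the old one. They may coincide, as for an arc joining \<open>I x\<close> to \<open>I y\<close>:
  such an arc collapses to a vertex.\<close>

lemma ancestor_arc:
  assumes "e \<in> arcs (under ((expand X ^^ k) G))"
  shows "ancestor k e \<in> arcs (under G) \<and>
    ancestor k (tail (under ((expand X ^^ k) G)) e) \<in>
      {tail (under G) (ancestor k e), head (under G) (ancestor k e)} \<and>
    ancestor k (head (under ((expand X ^^ k) G)) e) \<in>
      {tail (under G) (ancestor k e), head (under G) (ancestor k e)}"
  using assms
proof (induction k arbitrary: e)
  case 0
  then show ?case by simp
next
  case (Suc k)
  let ?G = "(expand X ^^ k) G"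
  obtain r e' where e: "e = prepend r e'" and e': "e' \<in> arcs (under ?G)"
    using Suc.prems by (auto elim: in_arcs_expandE)
  have "ancestor (Suc k) (replace_it (tail (under ?G) e') (head (under ?G) e') y) \<in>
      ancestor k ` {tail (under ?G) e', head (under ?G) e'}" for y
    unfolding ancestor_Suc using parent_replace_it by (intro imageI)
  then have "ancestor (Suc k) (tail (under (expand X ?G)) e) \<in>
      ancestor k ` {tail (under ?G) e', head (under ?G) e'}"
    "ancestor (Suc k) (head (under (expand X ?G)) e) \<in>
      ancestor k ` {tail (under ?G) e', head (under ?G) e'}"
    by (simp_all only: e expand_simps)
  then show ?case using Suc.IH[OF e'] by (auto simp: e)
qed

section \<open>Morphisms and lifts\<close>

definition cgraph_morphism ::
    "('a \<Rightarrow> 'a2) \<Rightarrow> ('b \<Rightarrow> 'b2) \<Rightarrow> ('a,'b,'c,'v) cgraph \<Rightarrow> ('a2,'b2,'c,'v) cgraph \<Rightarrow> bool" where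
  "cgraph_morphism \<phi> \<psi> G H \<longleftrightarrow>
     (\<forall>u\<in>verts (under G). \<phi> u \<in> verts (under H) \<and> vtyp H (\<phi> u) = vtyp G u) \<and>
     (\<forall>e\<in>arcs (under G). \<psi> e \<in> arcs (under H) \<and> ecol H (\<psi> e) = ecol G e \<and>
        tail (under H) (\<psi> e) = \<phi> (tail (under G) e) \<and>
        head (under H) (\<psi> e) = \<phi> (head (under G) e))"

text \<open>The letters put before a vertex depend only on its type, and the arcs that replace an
  arc only on its color, so a map respecting both carries over to the expansions once it commutes
  with \<open>prepend\<close>.\<close>

lemma cgraph_morphism_expand:
  assumes "cgraph_morphism \<phi> \<psi> G H"
    and \<phi>: "\<And>x u. \<phi> (prepend x u) = prepend x (\<phi> u)"
    and \<psi>: "\<And>r e. \<psi> (prepend r e) = prepend r (\<psi> e)"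
  shows "cgraph_morphism \<phi> \<psi> (expand X G) (expand X H)"
proof -
  have r: "\<phi> (replace_it u v y) = replace_it (\<phi> u) (\<phi> v) y" for u v y
    using \<phi> by (cases y) auto
  show ?thesis
    unfolding cgraph_morphism_def
  proof (intro conjI ballI; elim in_verts_expandE in_arcs_expandE)
  qed (use assms(1) in \<open>auto simp: cgraph_morphism_def prepend_in_verts_expand_iff
      prepend_in_arcs_expand_iff expand_simps \<phi> \<psi> r\<close>)
qed

lemma cgraph_morphism_expand_funpow:
  assumes "cgraph_morphism \<phi> \<psi> G H"
    and "\<And>x u. \<phi> (prepend x u) = prepend x (\<phi> u)"
    and "\<And>r e. \<psi> (prepend r e) = prepend r (\<psi> e)"
  shows "cgraph_morphism \<phi> \<psi> ((expand X ^^ k) G) ((expand X ^^ k) H)"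
  by (induction k) (auto intro: cgraph_morphism_expand assms)

lemma uwalk_cgraph_morphism:
  assumes "cgraph_morphism \<phi> \<psi> G H" and "uwalk (under G) u p v"
  shows "uwalk (under H) (\<phi> u) (map \<psi> p) (\<phi> v)"
  using assms(2) by (rule uwalk_map) (use assms(1) in \<open>auto simp: cgraph_morphism_def\<close>)

text \<open>The map of iterated expansions induced by \<open>f\<close>. The values of
  \<open>f\<close> already carry words, since the graph mapped to will itself be an expansion; the
  letters of \<open>u\<close> come later and stand in front.\<close>

definition extend :: "('a \<Rightarrow> 'x list \<times> 'b) \<Rightarrow> 'x list \<times> 'a \<Rightarrow> 'x list \<times> 'b" where
  "extend f u = (fst u @ fst (f (snd u)), snd (f (snd u)))"

lemma extend_Nil [simp]: "extend f ([], a) = f a"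
  by (simp add: extend_def)

lemma extend_prepend [simp]: "extend f (prepend x u) = prepend x (extend f u)"
  by (simp add: extend_def prod_eq_iff)

lemma extend_take_ancestor:
  "ancestor k u = f a \<Longrightarrow> extend f (take k (fst u), a) = u"
  by (auto simp: extend_def ancestor_def prod_eq_iff dest: sym)

text \<open>By induction on the levels: the morphism preserves types, so a letter that may be put
  before a vertex over \<open>H\<close> may also be put before its lift.\<close>

lemma lift_vert:
  assumes morph: "cgraph_morphism (extend p) (extend q) (zeroth_expansion G) H"
    and "u \<in> verts (under ((expand X ^^ k) H))"
    and "a \<in> verts (under G)" and "ancestor k u = p a"
  shows "(take k (fst u), a) \<in> verts (under (expansion X k G))"
  using assms(2,4)
proof (induction k arbitrary: u)
  case 0
  then show ?case using \<open>a \<in> verts (under G)\<close>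
    by (simp add: expansion_def zeroth_expansion_def)
next
  case (Suc k)
  let ?H = "(expand X ^^ k) H"
  obtain x u' where u: "u = prepend x u'" and u': "u' \<in> verts (under ?H)"
    and x: "x \<in> arcs (Sig X)" "tail (Sig X) x = vtyp ?H u'"
    using Suc.prems(1) by (auto elim: in_verts_expandE)
  define l where "l = (take k (fst u'), a)"
  have "ancestor k u' = p a" using Suc.prems(2) by (simp add: u)
  then have l: "l \<in> verts (under (expansion X k G))" "extend p l = u'"
    using Suc.IH[OF u'] by (auto simp: l_def extend_take_ancestor)
  then have "vtyp ?H u' = vtyp (expansion X k G) l"
    using cgraph_morphism_expand_funpow[OF morph extend_prepend extend_prepend, where X=X and k=k]
    unfolding cgraph_morphism_def expansion_def by auto
  then show ?case using l(1) x prepend_in_verts_expand_iff[of x l X "expansion X k G"]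
    by (simp add: u l_def expansion_def)
qed

text \<open>Colors now take the part of types: an arc and its lift have the same color and hence the
  same replacement graph.\<close>

lemma lift_arc:
  assumes morph: "cgraph_morphism (extend p) (extend q) (zeroth_expansion G) H"
    and "e \<in> arcs (under ((expand X ^^ k) H))"
    and "a \<in> arcs (under G)" and "ancestor k e = q a"
  shows "(take k (fst e), a) \<in> arcs (under (expansion X k G))"
  using assms(2,4)
proof (induction k arbitrary: e)
  case 0
  then show ?case using \<open>a \<in> arcs (under G)\<close>
    by (simp add: expansion_def zeroth_expansion_def)
next
  case (Suc k)
  let ?H = "(expand X ^^ k) H"
  obtain r e' where e: "e = prepend r e'" and e': "e' \<in> arcs (under ?H)"
    and r: "r \<in> arcs (under (repl X (ecol ?H e')))"
    using Suc.prems(1) by (auto elim: in_arcs_expandE)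
  define l where "l = (take k (fst e'), a)"
  have "ancestor k e' = q a" using Suc.prems(2) by (simp add: e)
  then have l: "l \<in> arcs (under (expansion X k G))" "extend q l = e'"
    using Suc.IH[OF e'] by (auto simp: l_def extend_take_ancestor)
  then have "ecol ?H e' = ecol (expansion X k G) l"
    using cgraph_morphism_expand_funpow[OF morph extend_prepend extend_prepend, where X=X and k=k]
    unfolding cgraph_morphism_def expansion_def by auto
  then show ?case using l(1) r prepend_in_arcs_expand_iff[of r l X "expansion X k G"]
    by (simp add: e l_def expansion_def)
qed

lemma verts_expansionD:
  "u \<in> verts (under (expansion X k G)) \<Longrightarrow> length (fst u) = k \<and> snd u \<in> verts (under G)"
  unfolding expansion_def
  by (induction k arbitrary: u)
    (auto simp: zeroth_expansion_def simp del: split_paired_All split_paired_Ex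
      elim!: in_verts_expandE)

lemma ancestor_extend:
  "length (fst z) = k \<Longrightarrow> ancestor k (extend f z) = f (snd z)"
  by (simp add: ancestor_def extend_def)

text \<open>Each arc projects to an arc or collapses to a vertex; the collapsed ones are left
  out.\<close>

lemma uwalk_ancestor:
  assumes "wf_digraph (under ((expand X ^^ k) G))" and "uwalk (under ((expand X ^^ k) G)) u p v"
  obtains q where "uwalk (under G) (ancestor k u) q (ancestor k v)" and "length q \<le> length p"
proof -
  let ?E = "(expand X ^^ k) G"
  have "\<exists>q. uwalk (under G) (ancestor k u) q (ancestor k v) \<and> length q \<le> length p"
    using assms(2)
  proof (induction p arbitrary: u)
    case Nil
    then show ?case using ancestor_vert[of u k X G] by (intro exI[of _ "[]"]) auto
  next
    case (Cons e p)
    then obtain u' where e: "e \<in> arcs (under ?E)" and u': "uwalk (under ?E) u' p v"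
      and "tail (under ?E) e = u \<and> head (under ?E) e = u' \<or>
        head (under ?E) e = u \<and> tail (under ?E) e = u'" unfolding uwalk.simps by blast
    then have ends: "{u, u'} = {tail (under ?E) e, head (under ?E) e}" by auto
    obtain q where q: "uwalk (under G) (ancestor k u') q (ancestor k v)" "length q \<le> length p"
      using Cons.IH[OF u'] by auto
    have a: "ancestor k e \<in> arcs (under G)"
      and "ancestor k ` {tail (under ?E) e, head (under ?E) e} \<subseteq>
        {tail (under G) (ancestor k e), head (under G) (ancestor k e)}"
      using ancestor_arc[OF e] by auto
    then have "{ancestor k u, ancestor k u'} \<subseteq>
        {tail (under G) (ancestor k e), head (under G) (ancestor k e)}"
      unfolding ends[symmetric] by simp
    then consider "ancestor k u = ancestor k u'"
      | "uwalk (under G) (ancestor k u) (ancestor k e # q) (ancestor k v)"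
      using a q(1) by auto
    then show ?case
    proof cases
      case 1
      then show ?thesis using q by (intro exI[of _ q]) auto
    next
      case 2
      then show ?thesis using q(2) by (intro exI[of _ "ancestor k e # q"]) auto
    qed
  qed
  then show thesis using that by blast
qed

text \<open>
  If no shorter walk joins the ancestors, then a walk of length \<open>n\<close> in the expansion projects to a
  path of length \<open>n\<close>, and it lifts to a geodesic of the expansion of that path alone.
\<close>

lemma n_expanding_uwalk:
  fixes H :: "('e list \<times> 'a, 'r list \<times> 'b, 'c, 'v) cgraph"
    and X :: "('v,'e,'c,'r,'l) vers"
  assumes X: "is_vers X" and n: "n_expanding X n" and H: "compatible X H"
    and p: "uwalk (under ((expand X ^^ n) H)) u p v" "length p = n"
  shows "\<exists>q. uwalk (under H) (ancestor n u) q (ancestor n v) \<and> length q < n"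
proof (rule ccontr)
  assume "\<not> ?thesis"
  then have no_short: "n \<le> length q" if "uwalk (under H) (ancestor n u) q (ancestor n v)" for q
    using that by (meson not_le)
  let ?E = "(expand X ^^ n) H"
  have "compatible X ?E" by (rule compatible_expand_funpow[OF X H])
  then interpret E: wf_digraph "under ?E" by (simp add: compatible_def)
  obtain f where f0: "f 0 = u" and fn: "f n = v"
    and f: "\<And>i. i < n \<Longrightarrow> p ! i \<in> arcs (under ?E) \<and>
      (tail (under ?E) (p ! i) = f i \<and> head (under ?E) (p ! i) = f (Suc i) \<or>
       tail (under ?E) (p ! i) = f (Suc i) \<and> head (under ?E) (p ! i) = f i)"
    by (rule uwalk_seqE[OF p(1), unfolded p(2)]) blast
  have f_verts: "f i \<in> verts (under ?E)" if "i \<le> n" for i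
  proof (cases "i = n")
    case True
    then show ?thesis using fn uwalk_end_in_verts[OF p(1)] by simp
  next
    case False
    then have "i < n" using that by simp
    then show ?thesis using f[of i] by (metis E.tail_in_verts E.head_in_verts)
  qed
  define P where "P i = ancestor n (f i)" for i
  define Q where "Q i = ancestor n (p ! i)" for i
  have P_verts: "P i \<in> verts (under H)" if "i \<le> n" for i
    unfolding P_def using f_verts[OF that] by (rule ancestor_vert)
  \<comment> \<open>Between two visits of one vertex the projection could be cut: the projected
    pieces before \<open>i\<close> and after \<open>j\<close> would join to fewer than
    \<open>n\<close> arcs.\<close>
  have P_neq: "P i \<noteq> P j" if "i < j" "j \<le> n" for i j
  proof
    assume eq: "P i = P j"
    have "uwalk (under ?E) (f 0) (map ((!) p) [0..<i]) (f i)"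
      using that by (intro uwalk_of_seq f_verts f) auto
    then obtain q1 where q1: "uwalk (under H) (ancestor n (f 0)) q1 (ancestor n (f i))"
      "length q1 \<le> length (map ((!) p) [0..<i])"
      by (rule uwalk_ancestor[OF E.wf_digraph])
    have "uwalk (under ?E) (f j) (map ((!) p) [j..<n]) (f n)"
      using that by (intro uwalk_of_seq f_verts f) auto
    then obtain q2 where q2: "uwalk (under H) (ancestor n (f j)) q2 (ancestor n (f n))"
      "length q2 \<le> length (map ((!) p) [j..<n])"
      by (rule uwalk_ancestor[OF E.wf_digraph])
    have "uwalk (under H) (ancestor n u) (q1 @ q2) (ancestor n v)"
      using q1(1) q2(1) eq uwalk_append unfolding P_def f0 fn by metis
    then have "n \<le> length (q1 @ q2)" by (rule no_short)
    then show False using q1(2) q2(2) that by simp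
  qed
  then have P_inj: "i = j" if "P i = P j" "i \<le> n" "j \<le> n" for i j
    using that by (metis linorder_neqE_nat)
  have Q: "Q i \<in> arcs (under H)"
    "tail (under H) (Q i) = P i \<and> head (under H) (Q i) = P (Suc i) \<or>
     tail (under H) (Q i) = P (Suc i) \<and> head (under H) (Q i) = P i" if "i < n" for i
  proof -
    have "P i \<noteq> P (Suc i)" using that by (intro P_neq) auto
    moreover have "P i \<in> {tail (under H) (Q i), head (under H) (Q i)} \<and>
        P (Suc i) \<in> {tail (under H) (Q i), head (under H) (Q i)}"
      using ancestor_arc[of "p ! i" n X H] f[OF that] unfolding P_def Q_def by auto
    ultimately show "tail (under H) (Q i) = P i \<and> head (under H) (Q i) = P (Suc i) \<or>
     tail (under H) (Q i) = P (Suc i) \<and> head (under H) (Q i) = P i" by auto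
    show "Q i \<in> arcs (under H)"
      using ancestor_arc[of "p ! i" n X H] f[OF that] unfolding Q_def by auto
  qed
  \<comment> \<open>A copy of the projected path on natural numbers, as \<open>n_expanding\<close>
    quantifies over such graphs. Arc \<open>i\<close> joins \<open>i\<close> and
    \<open>Suc i\<close> and is oriented like \<open>Q i\<close>.\<close>
  define G :: "(nat,nat,'c,'v) cgraph" where
    "G = \<lparr> under = \<lparr> verts = {0..n}, arcs = {0..<n},
             tail = (\<lambda>i. if tail (under H) (Q i) = P i then i else Suc i),
             head = (\<lambda>i. if tail (under H) (Q i) = P i then Suc i else i) \<rparr>,
           ecol = (\<lambda>i. ecol H (Q i)), vtyp = (\<lambda>i. vtyp H (P i)) \<rparr>"
  have G_ends: "P (tail (under G) i) = tail (under H) (Q i) \<and>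
      P (head (under G) i) = head (under H) (Q i)" if "i < n" for i
    using Q(2)[OF that] by (auto simp: G_def)
  have G: "compatible X G"
    unfolding compatible_def
  proof (intro conjI ballI)
    show "wf_digraph (under G)" by unfold_locales (auto simp: G_def)
    show "vtyp G i \<in> verts (Sig X)" if "i \<in> verts (under G)" for i
      using that P_verts[of i] H by (auto simp: G_def compatible_def)
    fix i assume "i \<in> arcs (under G)"
    then have i: "i < n" by (simp add: G_def)
    have "vtyp G j = vtyp H (P j)" "ecol G j = ecol H (Q j)" for j by (simp_all add: G_def)
    then show "ecol G i \<in> colors X"
      "vtyp G (tail (under G) i) = fst (kappa X (ecol G i))"
      "vtyp G (head (under G) i) = snd (kappa X (ecol G i))"
      using Q(1)[OF i] G_ends[OF i] H by (auto simp: compatible_def)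
  qed
  have path: "is_path_graph (under G) n 0 n"
    unfolding is_path_graph_def
    by (intro exI[of _ id]) (auto simp: G_def)
  have morph: "cgraph_morphism (extend P) (extend Q) (zeroth_expansion G) H"
    using P_verts Q(1) G_ends unfolding cgraph_morphism_def
    by (auto simp: zeroth_expansion_def) (auto simp: G_def)
  let ?F = "expansion X n G"
  have morph_n: "cgraph_morphism (extend P) (extend Q) ?F ?E"
    unfolding expansion_def
    by (rule cgraph_morphism_expand_funpow[OF morph extend_prepend extend_prepend])
  have "compatible X ?F"
    unfolding expansion_def
    by (intro compatible_expand_funpow compatible_zeroth_expansion X G)
  then interpret F: wf_digraph "under ?F" by (simp add: compatible_def)
  \<comment> \<open>The lift of \<open>f i\<close>: its latest \<open>n\<close> letters, placed
    above the vertex \<open>i\<close> of the path.\<close>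
  define l where "l i = (take n (fst (f i)), i)" for i
  have l: "l i \<in> verts (under ?F)" "extend P (l i) = f i" if "i \<le> n" for i
    unfolding l_def using that f_verts[OF that]
    by (auto intro!: lift_vert[OF morph] extend_take_ancestor simp: P_def) (simp add: G_def)
  \<comment> \<open>Arcs are lifted one at a time. As \<open>P\<close> is injective, the ends of a
    lifted arc are determined by their images, so consecutive lifts fit together.\<close>
  have l_unique: "z = l i" if "z \<in> verts (under ?F)" "extend P z = f i" "i \<le> n" for z i
  proof -
    have z: "length (fst z) = n" "snd z \<le> n"
      using verts_expansionD[OF that(1)] by (auto simp: G_def)
    then have "P (snd z) = P i" using ancestor_extend[of z n P] that(2) by (simp add: P_def)
    then have "snd z = i" using P_inj z(2) that(3) by blast
    moreover have "take n (fst (extend P z)) = fst z" using z(1) by (simp add: extend_def)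
    ultimately show ?thesis using that(2) by (auto simp: l_def prod_eq_iff)
  qed
  define a where "a i = (take n (fst (p ! i)), i)" for i
  have a: "a i \<in> arcs (under ?F)" "extend Q (a i) = p ! i" if "i < n" for i
    unfolding a_def using that f[OF that]
    by (auto intro!: lift_arc[OF morph] extend_take_ancestor simp: Q_def) (simp_all add: G_def)
  have "uwalk (under ?F) (l 0) (map a [0..<n]) (l n)"
  proof (rule uwalk_of_seq)
    fix k assume k: "k < n"
    have "extend P (tail (under ?F) (a k)) = tail (under ?E) (p ! k)"
      "extend P (head (under ?F) (a k)) = head (under ?E) (p ! k)"
      using morph_n a[OF k] unfolding cgraph_morphism_def by auto
    then have t: "tail (under ?E) (p ! k) = f i \<Longrightarrow> i \<le> n \<Longrightarrow> tail (under ?F) (a k) = l i"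
      and h: "head (under ?E) (p ! k) = f i \<Longrightarrow> i \<le> n \<Longrightarrow> head (under ?F) (a k) = l i" for i
      by (simp_all add: l_unique a(1)[OF k])
    have "tail (under ?F) (a k) = l k \<and> head (under ?F) (a k) = l (Suc k) \<or>
       tail (under ?F) (a k) = l (Suc k) \<and> head (under ?F) (a k) = l k"
      using f[OF k] t[of k] t[of "Suc k"] h[of k] h[of "Suc k"] k by linarith
    then show "a k \<in> arcs (under ?F) \<and>
      (tail (under ?F) (a k) = l k \<and> head (under ?F) (a k) = l (Suc k) \<or>
       tail (under ?F) (a k) = l (Suc k) \<and> head (under ?F) (a k) = l k)"
      using a(1)[OF k] by simp
  qed (use l in auto)
  \<comment> \<open>A competing walk in \<open>?F\<close> maps into \<open>?E\<close> and from there
    projects to \<open>H\<close>, where no walk between the ancestors has fewer than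
    \<open>n\<close> arcs.\<close>
  then have "geodesic (under ?F) (l 0) (map a [0..<n]) (l n)"
  proof (rule geodesicI)
    fix q assume "uwalk (under ?F) (l 0) q (l n)"
    then have "uwalk (under ?E) u (map (extend Q) q) v"
      using uwalk_cgraph_morphism[OF morph_n] l(2)[of 0] l(2)[of n] f0 fn by fastforce
    then obtain q' where "uwalk (under H) (ancestor n u) q' (ancestor n v)"
      and "length q' \<le> length (map (extend Q) q)"
      by (rule uwalk_ancestor[OF E.wf_digraph])
    then show "length (map a [0..<n]) \<le> length q" using no_short[of q'] by simp
  qed
  moreover have "l 0 \<in> successors X n G 0" "l n \<in> successors X n G n"
    using l(1)[of 0] l(1)[of n] by (auto simp: successors_def l_def)
  ultimately show False
    using n G path unfolding n_expanding_def by fastforce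
qed

section \<open>Walks in the graphs of a system\<close>

locale vers_system =
  fixes X :: "('v,'e,'c,'r,'l) vers"
  assumes is_vers: "is_vers X"
begin

sublocale Sig: fin_digraph "Sig X"
  using is_vers by (simp add: is_vers_def)

section \<open>The levels \<open>Gam X m\<close>: their words and types\<close>

lemma Gam_add: "Gam X (k + m) = (expand X ^^ k) (Gam X m)"
  by (simp add: Gam_def expansion_def funpow_add)

lemma Gam_Suc: "Gam X (Suc m) = expand X (Gam X m)"
  by (simp add: Gam_def expansion_def)

lemma compatible_Gam: "compatible X (Gam X m)"
  using is_vers unfolding Gam_def expansion_def
  by (intro compatible_expand_funpow compatible_zeroth_expansion) (auto simp: is_vers_def)

lemma wf_digraph_Gam: "wf_digraph (under (Gam X m))"
  using compatible_Gam by (simp add: compatible_def)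

definition word_type :: "'e list \<Rightarrow> 'v" where
  "word_type w = (if w = [] then start X else head (Sig X) (hd w))"

lemma awlast_rev: "Sig.awlast (start X) (rev w) = word_type w"
  by (cases w) (simp_all add: Sig.awalk_verts_conv word_type_def)

lemma lang_iff: "w \<in> lang X \<longleftrightarrow> Sig.awalk (start X) (rev w) (word_type w)"
  unfolding lang_def by (auto simp: awlast_rev[symmetric])

lemma Nil_in_lang: "[] \<in> lang X"
  using is_vers by (simp add: lang_iff word_type_def Sig.awalk_Nil_iff is_vers_def)

lemma Cons_in_lang_iff:
  "x # w \<in> lang X \<longleftrightarrow> w \<in> lang X \<and> x \<in> arcs (Sig X) \<and> tail (Sig X) x = word_type w"
  by (auto simp: lang_iff awlast_rev Sig.awalk_simps word_type_def)

text \<open>The two claims go through the induction together: the type of a word decides which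
  letters may be put before it.\<close>

lemma verts_Gam:
  "(w, ()) \<in> verts (under (Gam X m)) \<longleftrightarrow> w \<in> lang X \<and> length w = m"
  "(w, ()) \<in> verts (under (Gam X m)) \<Longrightarrow> vtyp (Gam X m) (w, ()) = word_type w"
proof (induction m arbitrary: w)
  case 0
  {
    case 1
    then show ?case using is_vers Nil_in_lang
      by (auto simp: Gam_def expansion_def zeroth_expansion_def is_vers_def)
  next
    case 2
    then show ?case using is_vers
      by (auto simp: Gam_def expansion_def zeroth_expansion_def is_vers_def word_type_def)
  }
next
  case (Suc m)
  have Cons: "(x # w, ()) = prepend x (w, ())" for x :: 'e and w by simp
  have Nil: "([], ()) \<notin> verts (under (Gam X (Suc m)))"
    unfolding Gam_Suc by (auto elim: in_verts_expandE dest: arg_cong[of _ _ fst])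
  {
    case 1
    then show ?case
    proof (cases w)
      case Nil
      then show ?thesis using \<open>([], ()) \<notin> _\<close> by simp
    next
      case (Cons x w')
      then show ?thesis using Suc.IH[of w']
        unfolding Gam_Suc Cons \<open>(x # w', ()) = _\<close> prepend_in_verts_expand_iff Cons_in_lang_iff
        by auto
    qed
  next
    case 2
    then show ?case using Nil
      by (cases w) (auto simp: Gam_Suc Cons vtyp_expand word_type_def simp del: prepend.simps)
  }
qed

text \<open>Distance at most \<open>k\<close> within one level, stated through walks so that
  infinite distances need no separate treatment. It also forces both words to lie on level
  \<open>m\<close>.\<close>

definition near :: "nat \<Rightarrow> nat \<Rightarrow> 'e list \<Rightarrow> 'e list \<Rightarrow> bool" where
  "near m k u v \<longleftrightarrow> (\<exists>p. uwalk (under (Gam X m)) (u, ()) p (v, ()) \<and> length p \<le> k)"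

lemma near_in_lang:
  assumes "near m k u v"
  shows "u \<in> lang X" "length u = m" "v \<in> lang X" "length v = m"
proof -
  obtain p where p: "uwalk (under (Gam X m)) (u, ()) p (v, ())"
    using assms unfolding near_def by (elim exE conjE)
  have "(u, ()) \<in> verts (under (Gam X m))" "(v, ()) \<in> verts (under (Gam X m))"
    using wf_digraph.uwalk_start_in_verts[OF wf_digraph_Gam p] uwalk_end_in_verts[OF p] by auto
  then show "u \<in> lang X" "length u = m" "v \<in> lang X" "length v = m" by (auto simp: verts_Gam(1))
qed

lemma near_refl: "u \<in> lang X \<Longrightarrow> near (length u) k u u"
  unfolding near_def by (intro exI[of _ "[]"]) (simp add: verts_Gam)

lemma nearI: "uwalk (under (Gam X m)) (u, ()) p (v, ()) \<Longrightarrow> length p \<le> k \<Longrightarrow> near m k u v"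
  unfolding near_def by (rule exI[of _ p]) (rule conjI)

lemma nearE:
  assumes "near m k u v"
  obtains p where "uwalk (under (Gam X m)) (u, ()) p (v, ())" and "length p \<le> k"
  using assms unfolding near_def by (elim exE conjE)

lemma near_mono:
  assumes "near m k u v" and "k \<le> l"
  shows "near m l u v"
  using assms(1) by (rule nearE) (rule nearI, assumption, use assms(2) in simp)

lemma near_trans:
  assumes "near m j u v" and "near m k v w"
  shows "near m (j + k) u w"
proof -
  obtain p where p: "uwalk (under (Gam X m)) (u, ()) p (v, ())" "length p \<le> j"
    using assms(1) by (rule nearE)
  obtain q where q: "uwalk (under (Gam X m)) (v, ()) q (w, ())" "length q \<le> k"
    using assms(2) by (rule nearE)
  show ?thesis using uwalk_append[OF p(1) q(1)] by (rule nearI) (use p(2) q(2) in simp)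
qed

lemma near_splitE:
  assumes "near m (j + k) u w"
  obtains v where "near m j u v" and "near m k v w"
proof -
  obtain p where p: "uwalk (under (Gam X m)) (u, ()) p (w, ())" "length p \<le> j + k"
    using assms by (rule nearE)
  then have "uwalk (under (Gam X m)) (u, ()) (take j p @ drop j p) (w, ())" by simp
  then obtain v where "uwalk (under (Gam X m)) (u, ()) (take j p) v"
    and "uwalk (under (Gam X m)) v (drop j p) (w, ())"
    by (rule wf_digraph.uwalk_splitE[OF wf_digraph_Gam])
  moreover have "v = (fst v, ())" by (simp add: prod_eq_iff)
  ultimately have "uwalk (under (Gam X m)) (u, ()) (take j p) (fst v, ())"
    and "uwalk (under (Gam X m)) (fst v, ()) (drop j p) (w, ())" by simp_all
  then show thesis using p(2) by (intro that[of "fst v"]) (auto elim!: nearI)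
qed

lemma near_project:
  assumes "near (j + m) k u v"
  shows "near m k (drop j u) (drop j v)"
proof -
  obtain p where p: "uwalk (under (Gam X (j + m))) (u, ()) p (v, ())" "length p \<le> k"
    using assms by (rule nearE)
  then obtain q where "uwalk (under (Gam X m)) (ancestor j (u, ())) q (ancestor j (v, ()))"
    and "length q \<le> length p"
    using uwalk_ancestor[of j X "Gam X m" "(u, ())" p "(v, ())"] wf_digraph_Gam[of "j + m"]
    unfolding Gam_add by blast
  then show ?thesis using p(2) unfolding near_def ancestor_def by auto
qed

text \<open>A walk of exactly \<open>n\<close> arcs falls under the expanding property; a shorter
  one merely projects and already satisfies the bound.\<close>

lemma near_contract_one:
  assumes "n_expanding X n" and "near (n + m) n u v"
  shows "\<exists>k<n. near m k (drop n u) (drop n v)"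
proof -
  obtain p where p: "uwalk (under (Gam X (n + m))) (u, ()) p (v, ())" "length p \<le> n"
    using assms(2) by (rule nearE)
  show ?thesis
  proof (cases "length p = n")
    case True
    then obtain q where "uwalk (under (Gam X m)) (ancestor n (u, ())) q (ancestor n (v, ()))"
      and "length q < n"
      using n_expanding_uwalk[OF is_vers assms(1) compatible_Gam] p(1) unfolding Gam_add by blast
    then show ?thesis unfolding near_def ancestor_def by auto
  next
    case False
    then have "near (n + m) (length p) u v" using p by (auto intro: nearI)
    then show ?thesis using near_project False p(2) by (intro exI[of _ "length p"]) auto
  qed
qed

text \<open>For \<open>n = 0\<close> the trivial walk at the empty word would contract to a walk of
  negative length.\<close>

lemma n_expanding_pos: "n_expanding X n \<Longrightarrow> n > 0"
  using near_contract_one[of n 0 "[]" "[]"] near_refl[OF Nil_in_lang, of n] by (cases "n = 0") auto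

text \<open>The walk is cut into \<open>q\<close> chunks of at most \<open>n\<close> arcs, each
  contracting to at most \<open>n - 1\<close>; the remaining \<open>r\<close> arcs only
  project.\<close>

lemma near_contract:
  assumes "n_expanding X n" and "near (n + m) (q * n + r) u v"
  shows "near m (q * (n - 1) + r) (drop n u) (drop n v)"
  using assms(2)
proof (induction q arbitrary: u)
  case 0
  then show ?case using near_project by simp
next
  case (Suc q)
  then obtain w where w: "near (n + m) n u w" "near (n + m) (q * n + r) w v"
    by (auto simp: add.assoc elim: near_splitE)
  obtain k where "k < n" "near m k (drop n u) (drop n w)"
    using near_contract_one[OF assms(1) w(1)] by blast
  then have "near m (n - 1) (drop n u) (drop n w)" using near_mono by fastforce
  from near_trans[OF this Suc.IH[OF w(2)]] show ?case by (simp add: add.assoc)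
qed

text \<open>
  With \<open>K = 2 n\<^sup>2\<close>, a walk longer than \<open>K\<close> shrinks by at least \<open>2 n\<close> when passing to the
  ancestors \<open>n\<close> levels up, which costs \<open>2 n\<close> vertical edges.
\<close>

lemma near_descend:
  assumes "n_expanding X n" and "near h t u v"
  shows "\<exists>s\<le>h. 2 * s \<le> t \<and> near (h - s) (2 * n * n) (drop s u) (drop s v)"
  using assms(2)
proof (induction t arbitrary: h u v rule: less_induct)
  case (less t)
  have n: "n > 0" using assms(1) by (rule n_expanding_pos)
  consider "t \<le> 2 * n * n" | "2 * n * n < t" "h < n" | "2 * n * n < t" "n \<le> h" by linarith
  then show ?case
  proof cases
    case 1
    then show ?thesis using less.prems near_mono by (intro exI[of _ 0]) auto
  next
    case 2
    \<comment> \<open>Fewer than \<open>n\<close> levels remain, so the descent may end at the empty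
      word; its cost is affordable because \<open>2 * h \<le> 2 * n * n < t\<close>.\<close>
    have "drop h u = []" "drop h v = []" using near_in_lang[OF less.prems] by auto
    then have "near (h - h) (2 * n * n) (drop h u) (drop h v)"
      using near_refl[OF Nil_in_lang] by simp
    moreover have "2 * h \<le> t"
    proof -
      have "2 * h \<le> 2 * n * n" using 2(2) n by (simp add: mult_le_mono)
      then show ?thesis using 2(1) by simp
    qed
    ultimately show ?thesis by blast
  next
    case 3
    define t' where "t' = t - 2 * n"
    have nn: "2 * n \<le> 2 * n * n" using n by simp
    then have t': "t' < t" "t = t' + 2 * n" using 3 n unfolding t'_def by linarith+
    \<comment> \<open>The bound \<open>t\<close> is split into \<open>2 * n\<close> chunks of length
      \<open>n\<close> and a remainder; each chunk loses one arc.\<close>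
    have "2 * n * (n - 1) + 2 * n = 2 * n * n" using n by (cases n) auto
    then have "2 * n * (n - 1) + (t - 2 * n * n) = t'" using 3 unfolding t'_def by simp
    moreover have "near (n + (h - n)) (2 * n * n + (t - 2 * n * n)) u v"
      using less.prems 3 by simp
    ultimately have "near (h - n) t' (drop n u) (drop n v)"
      using near_contract[OF assms(1), of "h - n" "2 * n" "t - 2 * n * n" u v] by simp
    then obtain s where s: "s \<le> h - n" "2 * s \<le> t'"
      "near (h - n - s) (2 * n * n) (drop s (drop n u)) (drop s (drop n v))"
      using less.IH[OF t'(1)] by blast
    then have "near (h - (s + n)) (2 * n * n) (drop (s + n) u) (drop (s + n) v)"
      by (simp add: add.commute)
    then show ?thesis using s(1,2) t' 3 by (intro exI[of _ "s + n"]) auto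
  qed
qed

section \<open>Hyperbolicity of the history graph\<close>

abbreviation "HG \<equiv> history_graph X"

lemma history_graph_simps:
  "verts HG = lang X"
  "Vertical x v \<in> arcs HG \<longleftrightarrow> x \<in> arcs (Sig X) \<and> v \<in> lang X \<and> x # v \<in> lang X"
  "Horizontal m e \<in> arcs HG \<longleftrightarrow> e \<in> arcs (under (Gam X m))"
  "tail HG (Vertical x v) = v"
  "head HG (Vertical x v) = x # v"
  "tail HG (Horizontal m e) = fst (tail (under (Gam X m)) e)"
  "head HG (Horizontal m e) = fst (head (under (Gam X m)) e)"
  by (auto simp: history_graph_def simp del: split_paired_Ex)

lemma fst_in_lang: "u \<in> verts (under (Gam X m)) \<Longrightarrow> fst u \<in> lang X \<and> length (fst u) = m"
  using verts_Gam(1)[of "fst u" m] by (cases u) auto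

lemma wf_digraph_history: "wf_digraph HG"
proof -
  have "tail HG h \<in> verts HG \<and> head HG h \<in> verts HG" if "h \<in> arcs HG" for h
  proof (cases h)
    case (Vertical x v)
    then show ?thesis using that by (simp add: history_graph_simps)
  next
    case (Horizontal m e)
    then have "e \<in> arcs (under (Gam X m))" using that by (simp add: history_graph_simps)
    then show ?thesis
      using wf_digraph.tail_in_verts[OF wf_digraph_Gam] wf_digraph.head_in_verts[OF wf_digraph_Gam]
        fst_in_lang unfolding Horizontal history_graph_simps by blast
  qed
  then show ?thesis by unfold_locales auto
qed

section \<open>Comparison of walks in the history graph with walks within a level\<close>

lemma near_imp_uwalk:
  assumes "near m k u v"
  obtains p where "uwalk HG u p v" and "length p \<le> k"
proof -
  obtain p where p: "uwalk (under (Gam X m)) (u, ()) p (v, ())" "length p \<le> k"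
    using assms by (rule nearE)
  have "uwalk HG (fst (u, ())) (map (Horizontal m) p) (fst (v, ()))"
    using p(1) by (rule uwalk_map) (auto simp: history_graph_simps dest: fst_in_lang)
  then show thesis using that[of "map (Horizontal m) p"] p(2) by simp
qed

lemma uwalk_drop:
  assumes "w \<in> lang X" and "j \<le> length w"
  obtains p where "uwalk HG w p (drop j w)" and "length p = j"
proof -
  have "\<exists>p. uwalk HG w p (drop j w) \<and> length p = j"
    using assms
  proof (induction w arbitrary: j)
    case Nil
    then show ?case by (simp add: history_graph_simps)
  next
    case (Cons x w)
    show ?case
    proof (cases j)
      case 0
      then show ?thesis using Cons.prems by (simp add: history_graph_simps)
    next
      case (Suc i)
      have w: "w \<in> lang X" "x \<in> arcs (Sig X)" using Cons.prems by (auto simp: Cons_in_lang_iff)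
      then obtain p where "uwalk HG w p (drop i w)" "length p = i"
        using Cons.IH[of i] Cons.prems Suc by auto
      then show ?thesis using Suc w Cons.prems
        by (intro exI[of _ "Vertical x w # p"]) (auto simp: history_graph_simps)
    qed
  qed
  then show thesis using that by blast
qed

text \<open>The ancestor on level \<open>h\<close>: words are written backwards, so the first
  \<open>h\<close> edges of the path are the last \<open>h\<close> entries of the list.\<close>

definition prefix_at :: "nat \<Rightarrow> 'e list \<Rightarrow> 'e list" where
  "prefix_at h w = drop (length w - h) w"

lemma prefix_at_length [simp]: "prefix_at (length w) w = w"
  by (simp add: prefix_at_def)

lemma drop_prefix_at: "s \<le> h \<Longrightarrow> h \<le> length w \<Longrightarrow> drop s (prefix_at h w) = prefix_at (h - s) w"
  by (simp add: prefix_at_def add.commute)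

lemma prefix_at_Cons: "h \<le> length w \<Longrightarrow> prefix_at h (x # w) = prefix_at h w"
  by (simp add: prefix_at_def Suc_diff_le)

lemma near_prefix_at:
  assumes "near h k (prefix_at h u) (prefix_at h v)"
    and "i \<le> h" and "h \<le> length u" and "h \<le> length v"
  shows "near i k (prefix_at i u) (prefix_at i v)"
  using near_project[of "h - i" i k "prefix_at h u" "prefix_at h v"] assms
  by (simp add: drop_prefix_at)

text \<open>Pass from \<open>u\<close> to its ancestor on level \<open>h\<close>, cross there, and
  return to \<open>v\<close>. Adding \<open>2 * h\<close> on the left avoids truncated
  subtraction.\<close>

lemma uwalk_via_prefix:
  assumes "u \<in> lang X" and "v \<in> lang X" and "h \<le> length u" and "h \<le> length v"
    and "near h t (prefix_at h u) (prefix_at h v)"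
  obtains p where "uwalk HG u p v" and "length p + 2 * h \<le> length u + length v + t"
proof -
  obtain p where p: "uwalk HG u p (prefix_at h u)" "length p = length u - h"
    unfolding prefix_at_def by (rule uwalk_drop[OF assms(1), of "length u - h"]) auto
  obtain q where q: "uwalk HG v q (prefix_at h v)" "length q = length v - h"
    unfolding prefix_at_def by (rule uwalk_drop[OF assms(2), of "length v - h"]) auto
  obtain r where r: "uwalk HG (prefix_at h u) r (prefix_at h v)" "length r \<le> t"
    using assms(5) by (rule near_imp_uwalk)
  have "uwalk HG u (p @ r @ rev q) v"
    using p(1) q(1) r(1) by (intro uwalk_append wf_digraph.uwalk_rev[OF wf_digraph_history])
  then show thesis using that p(2) q(2) r(2) assms(3,4) by fastforce
qed

text \<open>
  \<open>h\<close> is the lowest level on the walk, and \<open>t\<close> is the number of its horizontal edges, all of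
  which are projected to that level.
\<close>

lemma uwalk_imp_near:
  assumes "uwalk HG u p v"
  shows "\<exists>h t. h \<le> length u \<and> h \<le> length v \<and> near h t (prefix_at h u) (prefix_at h v) \<and>
    length u + length v + t \<le> length p + 2 * h"
  using assms
proof (induction p arbitrary: u)
  case Nil
  then have "u \<in> lang X" "u = v" by (auto simp: history_graph_simps)
  then show ?case
    using near_refl[of u 0] by (intro exI[of _ "length u"] exI[of _ 0]) auto
next
  case (Cons e p)
  then obtain u' where e: "e \<in> arcs HG" and u': "uwalk HG u' p v"
    and ends: "tail HG e = u \<and> head HG e = u' \<or> tail HG e = u' \<and> head HG e = u"
    unfolding uwalk.simps by blast
  obtain h t where h: "h \<le> length u'" "h \<le> length v"
    and near: "near h t (prefix_at h u') (prefix_at h v)"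
    and len: "length u' + length v + t \<le> length p + 2 * h"
    using Cons.IH[OF u'] by blast
  consider (down) x where "u' = x # u" | (up) x where "u = x # u'"
    | (hor) m a where "a \<in> arcs (under (Gam X m))"
      "fst (tail (under (Gam X m)) a) = u \<and> fst (head (under (Gam X m)) a) = u' \<or>
       fst (tail (under (Gam X m)) a) = u' \<and> fst (head (under (Gam X m)) a) = u"
    using e ends by (cases e) (auto simp: history_graph_simps)
  then show ?case
  proof cases
    case down
    show ?thesis
    proof (cases "h \<le> length u")
      case True
      then show ?thesis using h near len down
        by (intro exI[of _ h] exI[of _ t]) (auto simp: prefix_at_Cons)
    next
      case False
      \<comment> \<open>Here \<open>u\<close> lies just before level \<open>h\<close>, so the level
        must be lowered by one and the horizontal walk projected. The new edge and the shorter end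
        word make up for the loss of 2 in \<open>2 * h\<close>.\<close>
      then have hu: "h = Suc (length u)" using h(1) down by simp
      have "near (length u) t (prefix_at (length u) u') (prefix_at (length u) v)"
        using near_prefix_at[OF near _ h] hu by simp
      then show ?thesis using h len down hu
        by (intro exI[of _ "length u"] exI[of _ t]) (auto simp: prefix_at_Cons)
    qed
  next
    case up
    then show ?thesis using h near len
      by (intro exI[of _ h] exI[of _ t]) (auto simp: prefix_at_Cons)
  next
    case hor
    have verts: "tail (under (Gam X m)) a \<in> verts (under (Gam X m))"
      "head (under (Gam X m)) a \<in> verts (under (Gam X m))"
      using wf_digraph.wellformed[OF wf_digraph_Gam hor(1)] by auto
    have "uwalk (under (Gam X m)) (u, ()) [a] (u', ())"
      using hor verts by (auto simp: prod_eq_iff)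
    then have nm: "near m 1 u u'" unfolding near_def by (intro exI[of _ "[a]"]) auto
    note uu' = near_in_lang[OF nm]
    \<comment> \<open>The horizontal edge is projected from its own level \<open>m\<close> to level
      \<open>h\<close> and added to the walk found there.\<close>
    have "near h 1 (prefix_at h u) (prefix_at h u')"
      using near_prefix_at[of m 1 u u' h] nm uu' h(1) by (metis le_refl prefix_at_length)
    then have "near h (1 + t) (prefix_at h u) (prefix_at h v)" using near near_trans by blast
    then show ?thesis using h len uu' by (intro exI[of _ h] exI[of _ "1 + t"]) auto
  qed
qed

section \<open>Connectedness and distances of the history graph\<close>

lemma uwalk_connected:
  assumes "u \<in> lang X" and "v \<in> lang X"
  obtains p where "uwalk HG u p v"
proof -
  \<comment> \<open>Level 0 consists of the empty word alone, where all words meet.\<close>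
  have "near 0 0 (prefix_at 0 u) (prefix_at 0 v)"
    using near_refl[OF Nil_in_lang, of 0] by (simp add: prefix_at_def)
  then show thesis by (rule uwalk_via_prefix[OF assms le0 le0]) (rule that)
qed

text \<open>Distances between words of \<open>lang X\<close> are finite, so \<open>the_enat\<close>
  is harmless there.\<close>

definition hdist :: "'e list \<Rightarrow> 'e list \<Rightarrow> nat" where
  "hdist u v = the_enat (gdist HG u v)"

lemma hdist_le: "uwalk HG u p v \<Longrightarrow> hdist u v \<le> length p"
  using gdist_le[of HG u p v] unfolding hdist_def by (cases "gdist HG u v") auto

lemma hdist_attained:
  assumes "u \<in> lang X" and "v \<in> lang X"
  obtains p where "uwalk HG u p v" and "hdist u v = length p"
proof -
  obtain p where "uwalk HG u p v" by (rule uwalk_connected[OF assms])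
  then obtain q where "uwalk HG u q v" "gdist HG u v = enat (length q)" by (rule gdist_attained)
  then show thesis using that by (simp add: hdist_def)
qed

lemma hdist_Nil: "u \<in> lang X \<Longrightarrow> hdist [] u = length u"
proof (rule antisym)
  assume u: "u \<in> lang X"
  obtain p where "uwalk HG u p []" "length p = length u"
    using uwalk_drop[OF u le_refl] by auto
  then show "hdist [] u \<le> length u"
    using hdist_le wf_digraph.uwalk_rev[OF wf_digraph_history] by (metis length_rev)
  obtain p where p: "uwalk HG [] p u" "hdist [] u = length p"
    by (rule hdist_attained[OF Nil_in_lang u])
  \<comment> \<open>One end is empty, so the level supplied by \<open>uwalk_imp_near\<close> can
    only be 0 and its estimate gives \<open>length u \<le> length p\<close>.\<close>
  show "length u \<le> hdist [] u" using uwalk_imp_near[OF p(1)] p(2) by auto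
qed

text \<open>Halved, the last inequality bounds the Gromov product at the empty word by
  \<open>h\<close>. A shortest walk yields a level with \<open>t\<close> horizontal edges;
  \<open>near_descend\<close> trades these for at most \<open>t / 2\<close> levels, which keeps the
  estimate.\<close>

lemma hdist_near:
  assumes "n_expanding X n" and "u \<in> lang X" and "v \<in> lang X"
  obtains h where "h \<le> length u" and "h \<le> length v"
    and "near h (2 * n * n) (prefix_at h u) (prefix_at h v)"
    and "length u + length v \<le> hdist u v + 2 * h"
proof -
  obtain p where p: "uwalk HG u p v" "hdist u v = length p"
    by (rule hdist_attained[OF assms(2,3)])
  obtain h t where h: "h \<le> length u" "h \<le> length v"
    "near h t (prefix_at h u) (prefix_at h v)" "length u + length v + t \<le> length p + 2 * h"
    using uwalk_imp_near[OF p(1)] by blast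
  obtain s where "s \<le> h" "2 * s \<le> t"
    "near (h - s) (2 * n * n) (drop s (prefix_at h u)) (drop s (prefix_at h v))"
    using near_descend[OF assms(1) h(3)] by blast
  then show thesis using that[of "h - s"] h p(2) by (auto simp: drop_prefix_at)
qed

text \<open>On the smaller of the two levels the ancestors of \<open>x\<close> and \<open>z\<close>
  are within \<open>2 * K\<close> of each other, and after at most \<open>K\<close> further levels
  within \<open>K\<close>. Both losses together lower the product by at most
  \<open>3 * K / 2\<close>, which is \<open>3 * n * n\<close>.\<close>

lemma gromov_product_history:
  assumes "n_expanding X n" and "x \<in> lang X" and "y \<in> lang X" and "z \<in> lang X"
  defines "g \<equiv> gromov_product (\<lambda>u v. real (hdist u v)) []"
  shows "g x z \<ge> min (g x y) (g y z) - real (3 * n * n)"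
proof -
  define K where "K = 2 * n * n"
  have g: "2 * g u v = real (length u) + real (length v) - real (hdist u v)"
    if "u \<in> lang X" "v \<in> lang X" for u v
    using that unfolding g_def gromov_product_def by (simp add: hdist_Nil)
  obtain i where i: "i \<le> length x" "i \<le> length y" "near i K (prefix_at i x) (prefix_at i y)"
    "length x + length y \<le> hdist x y + 2 * i"
    unfolding K_def by (rule hdist_near[OF assms(1,2,3)])
  obtain j where j: "j \<le> length y" "j \<le> length z" "near j K (prefix_at j y) (prefix_at j z)"
    "length y + length z \<le> hdist y z + 2 * j"
    unfolding K_def by (rule hdist_near[OF assms(1,3,4)])
  define h where "h = min i j"
  have h: "h \<le> i" "h \<le> j" "h \<le> length x" "h \<le> length z" using i j by (auto simp: h_def)
  have "near h (K + K) (prefix_at h x) (prefix_at h z)"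
    using near_prefix_at[OF i(3) h(1) i(1,2)] near_prefix_at[OF j(3) h(2) j(1,2)] by (rule near_trans)
  then obtain s where s: "s \<le> h" "2 * s \<le> K + K"
    "near (h - s) K (drop s (prefix_at h x)) (drop s (prefix_at h z))"
    using near_descend[OF assms(1)] unfolding K_def by blast
  then have "near (h - s) K (prefix_at (h - s) x) (prefix_at (h - s) z)"
    using h by (simp add: drop_prefix_at)
  then obtain p where "uwalk HG x p z" "length p + 2 * (h - s) \<le> length x + length z + K"
    using h by (elim uwalk_via_prefix[OF assms(2,4), rotated 2]) auto
  then have "hdist x z + 2 * (h - s) \<le> length x + length z + K" using hdist_le by fastforce
  then have "hdist x z + 2 * h \<le> length x + length z + 3 * K" using s by linarith
  \<comment> \<open>As \<open>h\<close> is \<open>i\<close> or \<open>j\<close>, one of the two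
    given products is at most \<open>h\<close>.\<close>
  moreover have "length x + length y \<le> hdist x y + 2 * h \<or> length y + length z \<le> hdist y z + 2 * h"
    using i(4) j(4) unfolding h_def by linarith
  ultimately have "2 * g x z \<ge> 2 * g x y - 3 * real K \<or> 2 * g x z \<ge> 2 * g y z - 3 * real K"
    unfolding g[OF assms(2,3)] g[OF assms(2,4)] g[OF assms(3,4)] by linarith
  moreover have "3 * real K = 2 * real (3 * n * n)" by (simp add: K_def)
  ultimately show ?thesis by linarith
qed

end

theorem theorem3p12:
  fixes X :: "('v,'e,'c,'r,'l) vers"
  assumes "is_vers X" and "expanding X"
  shows "hyperbolic_graph (history_graph X)"
proof -
  interpret vers_system X using assms(1) by unfold_locales
  obtain n where n: "n_expanding X n" using assms(2) unfolding expanding_def by blast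
  have "gdist HG u v \<noteq> \<infinity>" if "u \<in> verts HG" "v \<in> verts HG" for u v
  proof -
    obtain p where "uwalk HG u p v"
      using uwalk_connected[of u v] \<open>u \<in> verts HG\<close> \<open>v \<in> verts HG\<close>
      by (auto simp: history_graph_simps)
    from gdist_le[OF this] show ?thesis by (cases "gdist HG u v") auto
  qed
  moreover have "gromov_hyperbolic (verts HG) (\<lambda>u v. real (hdist u v))"
  proof (rule gromov_hyperbolic_if_one_base[of "real (3 * n * n)" "[]"])
    show "real (hdist u v) = real (hdist v u)" for u v
      unfolding hdist_def using wf_digraph.gdist_sym[OF wf_digraph_history] by metis
  qed (use gromov_product_history[OF n] Nil_in_lang in \<open>auto simp: history_graph_simps\<close>)
  ultimately show ?thesis unfolding hyperbolic_graph_def hdist_def by blast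
qed

end
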